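(* The principal 3D slice $\mathcal{T}(\mathbf{i_1},\mathbf{i_2},\mathbf{i_3})$ of the tricomplex Mandelbrot set (the Metabrot) can be characterized as $$\mathcal{T}(\mathbf{i_1},\mathbf{i_2},\mathbf{i_3}) = \bigcup_{y\in[-m,m]}\{[(A-y\,\mathbf{i_2})\cap(A+y\,\mathbf{i_2})] + y\,\mathbf{i_3}\},$$ where $$A:=\{a\in\mathrm{span}_{\mathbb{R}}\{\mathbf{i_1},\mathbf{i_2}\}:\{P_{a}^{(n)}(0)\}_{n\in\mathbb{N}}\text{ is bounded}\}$$ and $$m:=\sup\{q\in\mathbb{R}:\exists p\in\mathbb{R}\text{ such that }p+q\,\mathbf{i_1}\in\mathcal{M}_1\}.$$
   Context: The tricomplex numbers $\mathbb{TC}$ form the commutative, associative unital real algebra generated by three commuting elements $\mathbf{i_1},\mathbf{i_2},\mathbf{i_3}$ with $\mathbf{i_1}^2=\mathbf{i_2}^2=\mathbf{i_3}^2=-1$; it has dimension 8 over $\mathbb{R}$ with basis $1,\mathbf{i_1},\mathbf{i_2},\mathbf{j_1},\mathbf{i_3},\mathbf{j_2},\mathbf{j_3},\mathbf{i_4}$, where $\mathbf{j_1}=\mathbf{i_1}\mathbf{i_2}$, $\mathbf{j_2}=\mathbf{i_1}\mathbf{i_3}$, $\mathbf{j_3}=\mathbf{i_2}\mathbf{i_3}$ and $\mathbf{i_4}=\mathbf{i_1}\mathbf{i_2}\mathbf{i_3}$. Boundedness in $\mathbb{TC}\cong\mathbb{R}^8$ is with respect to the Euclidean norm. For $c\in\mathbb{TC}$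 let $P_c(\eta)=\eta^2+c$ and let $P_c^{(n)}$ be its $n$-fold composition. The tricomplex Mandelbrot set is $\mathcal{M}_3=\{c\in\mathbb{TC}:\{P_c^{(n)}(0)\}_{n\in\mathbb{N}}\text{ is bounded}\}$. The classical Mandelbrot set is $\mathcal{M}_1=\{c\in\mathbb{C}(\mathbf{i_1}):\{P_c^{(n)}(0)\}_{n\in\mathbb{N}}\text{ is bounded}\}$, where $\mathbb{C}(\mathbf{i_1})=\{x+y\mathbf{i_1}:x,y\in\mathbb{R}\}\subset\mathbb{TC}$. For three distinct units $\mathbf{u},\mathbf{v},\mathbf{w}\in\{1,\mathbf{i_1},\mathbf{i_2},\mathbf{j_1},\mathbf{i_3},\mathbf{j_2},\mathbf{j_3},\mathbf{i_4}\}$, the principal 3D slice is $\mathcal{T}(\mathbf{u},\mathbf{v},\mathbf{w})=\mathrm{span}_{\mathbb{R}}\{\mathbf{u},\mathbf{v},\mathbf{w}\}\cap\mathcal{M}_3$. For a set $S\subset\mathbb{TC}$ and $z\in\mathbb{TC}$, $S\pm z=\{s\pm z:s\in S\}$. *)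

theory Defs
  imports "HOL-Analysis.Analysis"
begin

section \<open>Adjoining a commuting square root of $-1$\<close>

text \<open>For a commutative ring $R$, the type \<open>R adj\<close> is $R[x]/(x^2 + 1)$: the element \<open>Adj a b\<close> is
  $a + b x$. Tricomplex numbers are obtained from the reals by doing this three times, the
  first time being the library type \<^typ>\<open>complex\<close>.\<close>

codatatype 'a adj = Adj (base: 'a) (adjoined: 'a)

lemma adj_eq_iff: "z = w \<longleftrightarrow> base z = base w \<and> adjoined z = adjoined w"
  by (auto intro: adj.expand)

instantiation adj :: (ab_group_add) ab_group_add
begin

primcorec zero_adj :: "'a adj" where
  "base 0 = 0"
| "adjoined 0 = 0"

primcorec plus_adj :: "'a adj \<Rightarrow> 'a adj \<Rightarrow> 'a adj" where
  "base (z + w) = base z + base w"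
| "adjoined (z + w) = adjoined z + adjoined w"

primcorec uminus_adj :: "'a adj \<Rightarrow> 'a adj" where
  "base (- z) = - base z"
| "adjoined (- z) = - adjoined z"

primcorec minus_adj :: "'a adj \<Rightarrow> 'a adj \<Rightarrow> 'a adj" where
  "base (z - w) = base z - base w"
| "adjoined (z - w) = adjoined z - adjoined w"

instance
  by standard (simp_all add: adj_eq_iff)

end

instantiation adj :: (comm_ring_1) comm_ring_1
begin

primcorec one_adj :: "'a adj" where
  "base 1 = 1"
| "adjoined 1 = 0"

primcorec times_adj :: "'a adj \<Rightarrow> 'a adj \<Rightarrow> 'a adj" where
  "base (z * w) = base z * base w - adjoined z * adjoined w"
| "adjoined (z * w) = base z * adjoined w + adjoined z * base w"

instance
  by standard (simp_all add: adj_eq_iff algebra_simps)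

end

instantiation adj :: (real_vector) real_vector
begin

primcorec scaleR_adj :: "real \<Rightarrow> 'a adj \<Rightarrow> 'a adj" where
  "base (r *\<^sub>R z) = r *\<^sub>R base z"
| "adjoined (r *\<^sub>R z) = r *\<^sub>R adjoined z"

instance
  by standard (simp_all add: adj_eq_iff algebra_simps)

end

instance adj :: ("{comm_ring_1, real_algebra_1}") real_algebra_1
  by standard (simp_all add: adj_eq_iff algebra_simps)

text \<open>The inner product is that of the direct sum, so the norm is the Euclidean one and not an
  algebra norm.\<close>

instantiation adj :: (real_inner) real_inner
begin

definition inner_adj :: "'a adj \<Rightarrow> 'a adj \<Rightarrow> real" where
  "inner_adj z w = inner (base z) (base w) + inner (adjoined z) (adjoined w)"

definition norm_adj :: "'a adj \<Rightarrow> real" where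
  "norm_adj z = sqrt (inner z z)"

definition sgn_adj :: "'a adj \<Rightarrow> 'a adj" where
  "sgn_adj z = z /\<^sub>R norm z"

definition dist_adj :: "'a adj \<Rightarrow> 'a adj \<Rightarrow> real" where
  "dist_adj z w = norm (z - w)"

definition uniformity_adj :: "('a adj \<times> 'a adj) filter" where
  "uniformity_adj = (INF e\<in>{0 <..}. principal {(z, w). dist z w < e})"

definition open_adj :: "'a adj set \<Rightarrow> bool" where
  "open_adj U \<longleftrightarrow> (\<forall>z\<in>U. eventually (\<lambda>(z', w). z' = z \<longrightarrow> w \<in> U) uniformity)"

instance
proof
  fix z w v :: "'a adj" and r :: real
  show "inner z w = inner w z"
    by (simp add: inner_adj_def inner_commute)
  show "inner (z + w) v = inner z v + inner w v" "inner (r *\<^sub>R z) w = r * inner z w"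
    by (simp_all add: inner_adj_def inner_add_left algebra_simps)
  show "0 \<le> inner z z"
    by (simp add: inner_adj_def)
  show "inner z z = 0 \<longleftrightarrow> z = 0"
    by (simp add: inner_adj_def adj_eq_iff add_nonneg_eq_0_iff)
qed (simp_all add: norm_adj_def sgn_adj_def dist_adj_def uniformity_adj_def open_adj_def)

end

section \<open>Tricomplex numbers\<close>

type_synonym tricomplex = "complex adj adj"

definition i\<^sub>1 :: tricomplex where "i\<^sub>1 = Adj (Adj \<i> 0) 0"
definition i\<^sub>2 :: tricomplex where "i\<^sub>2 = Adj (Adj 0 1) 0"
definition i\<^sub>3 :: tricomplex where "i\<^sub>3 = Adj 0 1"

definition j\<^sub>1 :: tricomplex where "j\<^sub>1 = i\<^sub>1 * i\<^sub>2"
definition j\<^sub>2 :: tricomplex where "j\<^sub>2 = i\<^sub>1 * i\<^sub>3"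
definition j\<^sub>3 :: tricomplex where "j\<^sub>3 = i\<^sub>2 * i\<^sub>3"
definition i\<^sub>4 :: tricomplex where "i\<^sub>4 = i\<^sub>1 * i\<^sub>2 * i\<^sub>3"

lemmas unit_defs = i\<^sub>1_def i\<^sub>2_def i\<^sub>3_def j\<^sub>1_def j\<^sub>2_def j\<^sub>3_def i\<^sub>4_def

lemma generators_squared: "i\<^sub>1\<^sup>2 = -1" "i\<^sub>2\<^sup>2 = -1" "i\<^sub>3\<^sup>2 = -1"
  by (simp_all add: unit_defs adj_eq_iff power2_eq_square)

lemma tricomplex_coordinates:
  "of_real x\<^sub>0 + x\<^sub>1 *\<^sub>R i\<^sub>1 + x\<^sub>2 *\<^sub>R i\<^sub>2 + x\<^sub>3 *\<^sub>R j\<^sub>1 + x\<^sub>4 *\<^sub>R i\<^sub>3 + x\<^sub>5 *\<^sub>R j\<^sub>2 + x\<^sub>6 *\<^sub>R j\<^sub>3 + x\<^sub>7 *\<^sub>R i\<^sub>4 =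
   Adj (Adj (Complex x\<^sub>0 x\<^sub>1) (Complex x\<^sub>2 x\<^sub>3)) (Adj (Complex x\<^sub>4 x\<^sub>5) (Complex x\<^sub>6 x\<^sub>7))"
  by (simp add: unit_defs adj_eq_iff of_real_def complex_eq_iff)

lemma tricomplex_norm:
  "norm (Adj (Adj (Complex x\<^sub>0 x\<^sub>1) (Complex x\<^sub>2 x\<^sub>3)) (Adj (Complex x\<^sub>4 x\<^sub>5) (Complex x\<^sub>6 x\<^sub>7))) =
   sqrt (x\<^sub>0\<^sup>2 + x\<^sub>1\<^sup>2 + x\<^sub>2\<^sup>2 + x\<^sub>3\<^sup>2 + x\<^sub>4\<^sup>2 + x\<^sub>5\<^sup>2 + x\<^sub>6\<^sup>2 + x\<^sub>7\<^sup>2)"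
  by (simp add: norm_adj_def inner_adj_def inner_complex_def power2_eq_square)

section \<open>Mandelbrot sets\<close>

definition P :: "tricomplex \<Rightarrow> tricomplex \<Rightarrow> tricomplex" where
  "P c \<eta> = \<eta>\<^sup>2 + c"

definition M\<^sub>3 :: "tricomplex set" where
  "M\<^sub>3 = {c. bounded (range (\<lambda>n. (P c ^^ n) 0))}"

definition C_i\<^sub>1 :: "tricomplex set" where
  "C_i\<^sub>1 = {of_real x + y *\<^sub>R i\<^sub>1 |x y. True}"

definition M\<^sub>1 :: "tricomplex set" where
  "M\<^sub>1 = {c \<in> C_i\<^sub>1. bounded (range (\<lambda>n. (P c ^^ n) 0))}"

text \<open>Meant for three distinct elements of $\{1, i_1, i_2, j_1, i_3, j_2, j_3, i_4\}$.\<close>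

definition principal_slice :: "tricomplex \<Rightarrow> tricomplex \<Rightarrow> tricomplex \<Rightarrow> tricomplex set" where
  "principal_slice u v w = span {u, v, w} \<inter> M\<^sub>3"

end

theory Submission
  imports Defs
begin

text \<open>Let $j$ be a square root of $-1$ in a commutative real algebra $R$. Sending the adjoined root of \<open>R adj\<close> to
  $j$ or to $-j$ gives two ring homomorphisms to $R$; as polynomials commute with them, and as
  together they are a linear homeomorphism onto $R \times R$, an orbit of $z \mapsto z^2 + c$ over
  \<open>R adj\<close> is bounded iff the two orbits of the images of $c$ are
  (\<open>bounded_orbit_adj_iff\<close>). This is the idempotent decomposition in the disguise of
  evaluations.

  Taking $j = i_2$ and evaluating at $i_3 = \pm i_2$, the point $s + y i_3$ with $s$ in the span
  of $i_1$ and $i_2$ lies in the tricomplex Mandelbrot set iff both $s + y i_2$ and $s - y i_2$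
  lie in $A$, which is the asserted decomposition, but with $y$ ranging over all reals.
  It remains to see that such a $y$ always lies in $[-m, m]$.
  Evaluating once more at $i_2 = i_1$, the points $(x + t + y) i_1$ and $(x + t - y) i_1$ lie in
  the classical Mandelbrot set, where $s = x i_1 + t i_2$. That set is invariant under conjugation
  and its imaginary parts have the supremum $m$, finite by the escape radius 2
  (\<open>norm_le_2_if_bounded_orbit\<close>). So $x + t + y$ and $x + t - y$ are both in
  $[-m, m]$, and so is $y$, half their difference.\<close>

section \<open>Orbits of the critical point\<close>

definition orbit :: "'a::comm_ring_1 \<Rightarrow> nat \<Rightarrow> 'a" where
  "orbit c n = ((\<lambda>z. z\<^sup>2 + c) ^^ n) 0"

definition bounded_orbit :: "'a::{comm_ring_1, real_normed_vector} \<Rightarrow> bool" where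
  "bounded_orbit c \<longleftrightarrow> bounded (range (orbit c))"

lemma orbit_simps [simp]:
  "orbit c 0 = 0"
  "orbit c (Suc n) = (orbit c n)\<^sup>2 + c"
  by (simp_all add: orbit_def)

lemma bounded_orbit_iff_P: "bounded_orbit c \<longleftrightarrow> bounded (range (\<lambda>n. (P c ^^ n) 0))"
proof -
  have "P c = (\<lambda>z. z\<^sup>2 + c)"
    by (simp add: P_def fun_eq_iff)
  then show ?thesis
    by (simp add: bounded_orbit_def orbit_def[abs_def])
qed

lemma orbit_hom:
  assumes "f 0 = 0" "\<And>x y. f (x + y) = f x + f y" "\<And>x y. f (x * y) = f x * f y"
  shows "f (orbit c n) = orbit (f c) n"
  by (induction n) (simp_all add: assms power2_eq_square)

lemma bounded_orbit_cnj: "bounded_orbit (cnj c) \<longleftrightarrow> bounded_orbit c"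
proof -
  have "orbit (cnj c) n = cnj (orbit c n)" for n
    by (rule orbit_hom[symmetric]) simp_all
  then show ?thesis
    by (simp add: bounded_orbit_def bounded_iff)
qed

text \<open>Outside the disc of radius 2 the critical orbit gains at least $|c| - 2$ in absolute value
  at every step, because $|z^2 + c| \ge |z| (|z| - 1)$ as soon as $|z| \ge |c|$,
  and $|z| (|z| - 1) = |z| + |z| (|z| - 2)$.\<close>

lemma norm_le_2_if_bounded_orbit:
  fixes c :: complex
  assumes "bounded_orbit c"
  shows "norm c \<le> 2"
proof (rule ccontr)
  define e where "e = norm c - 2"
  assume "\<not> norm c \<le> 2"
  then have e: "e > 0"
    by (simp add: e_def)
  have growth: "norm (orbit c (Suc n)) \<ge> norm c + real n * e" for n
  proof (induction n)
    case 0
    show ?case by simp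
  next
    case (Suc n)
    define z where "z = orbit c (Suc n)"
    have zn: "norm z \<ge> norm c + real n * e"
      using Suc unfolding z_def .
    moreover have "real n * e \<ge> 0"
      using e by simp
    ultimately have z: "norm z \<ge> norm c"
      by linarith
    have "norm (z\<^sup>2 + c) \<ge> norm (z\<^sup>2) - norm c"
      by (rule norm_diff_ineq)
    also have "norm (z\<^sup>2) = norm z * norm z"
      by (simp add: power2_eq_square norm_mult)
    finally have "norm (z\<^sup>2 + c) \<ge> norm z * norm z - norm z"
      using z by linarith
    moreover have "norm z * (norm z - 2) \<ge> 1 * e"
      using z e by (intro mult_mono) (auto simp: e_def)
    ultimately have "norm (z\<^sup>2 + c) \<ge> norm z + e"
      by (simp add: algebra_simps)
    with zn have "norm (z\<^sup>2 + c) \<ge> norm c + real (Suc n) * e"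
      by (simp add: algebra_simps)
    then show ?case
      by (simp add: z_def)
  qed
  from assms obtain b where b: "norm (orbit c n) \<le> b" for n
    unfolding bounded_orbit_def bounded_iff by auto
  obtain n where "b < real n * e"
    using e reals_Archimedean3 by blast
  with growth[of n] b[of "Suc n"] norm_ge_zero[of c] show False
    by linarith
qed

section \<open>Evaluating the adjoined root\<close>

definition eval_root :: "'a::comm_ring_1 \<Rightarrow> 'a adj \<Rightarrow> 'a" where
  "eval_root j z = base z + j * adjoined z"

lemma eval_root_orbit:
  assumes "j * j = -1"
  shows "eval_root j (orbit c n) = orbit (eval_root j c) n"
proof (rule orbit_hom)
  fix x y
  have "eval_root j x * eval_root j y =
      base x * base y + (j * j) * (adjoined x * adjoined y) +
      j * (base x * adjoined y + adjoined x * base y)"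
    by (simp add: eval_root_def algebra_simps)
  then show "eval_root j (x * y) = eval_root j x * eval_root j y"
    by (simp add: assms eval_root_def)
qed (simp_all add: eval_root_def algebra_simps)

lemma norm_adj_eq: "norm z = sqrt ((norm (base z))\<^sup>2 + (norm (adjoined z))\<^sup>2)"
  by (simp add: norm_adj_def inner_adj_def power2_norm_eq_inner)

lemma bounded_linear_base: "bounded_linear base"
  and bounded_linear_adjoined: "bounded_linear adjoined"
  by (rule bounded_linear_intro[where K = 1]; simp add: norm_adj_eq real_le_rsqrt)+

lemma bounded_linear_Adj: "bounded_linear (\<lambda>x. Adj x 0)" "bounded_linear (\<lambda>x. Adj 0 x)"
  by (rule bounded_linear_intro[where K = 1]; simp add: norm_adj_eq adj_eq_iff)+

text \<open>The backward implication recovers the two coordinates of $z$ from the evaluations $u$ at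
  $j$ and $v$ at $-j$: they are $(u + v) / 2$ and, since $1 / j = -j$, $-j (u - v) / 2$. The norm
  on the ring need not be submultiplicative, hence the continuity assumption on $j$.\<close>

lemma bounded_orbit_adj_iff:
  fixes j :: "'a::{comm_ring_1, real_inner}"
  assumes j: "j * j = -1" and lin: "bounded_linear ((*) j)"
  shows "bounded_orbit c \<longleftrightarrow> bounded_orbit (eval_root j c) \<and> bounded_orbit (eval_root (- j) c)"
proof
  have ev: "orbit (eval_root k c) = (\<lambda>n. eval_root k (orbit c n))" if "k * k = -1" for k
    using eval_root_orbit[OF that, of c] by (simp add: fun_eq_iff)
  have eval: "bounded_orbit (eval_root k c)"
    if "bounded_orbit c" "k * k = -1" "bounded_linear ((*) k)" for k
  proof -
    have "bounded_linear (eval_root k)"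
      unfolding eval_root_def[abs_def]
      by (intro bounded_linear_add bounded_linear_base
          bounded_linear_compose[OF that(3)] bounded_linear_adjoined)
    with that(1) have "bounded (eval_root k ` range (orbit c))"
      unfolding bounded_orbit_def by (rule bounded_linear_image)
    then show ?thesis
      by (simp add: bounded_orbit_def ev[OF that(2)] image_image)
  qed
  have neg: "bounded_linear ((*) (- j))"
  proof -
    have "(*) (- j) = (\<lambda>x. - (j * x))"
      by (simp add: fun_eq_iff)
    then show ?thesis
      using bounded_linear_minus[OF lin] by simp
  qed
  {
    assume "bounded_orbit c"
    then show "bounded_orbit (eval_root j c) \<and> bounded_orbit (eval_root (- j) c)"
      using eval j lin neg by simp
  next
    assume "bounded_orbit (eval_root j c) \<and> bounded_orbit (eval_root (- j) c)"
    then have u: "bounded (range (\<lambda>n. eval_root j (orbit c n)))"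
      and v: "bounded (range (\<lambda>n. eval_root (- j) (orbit c n)))"
      using j by (simp_all add: bounded_orbit_def ev)
    define f where "f u = Adj (u /\<^sub>R 2) 0 + Adj 0 ((- j * u) /\<^sub>R 2)" for u :: 'a
    define g where "g v = Adj (v /\<^sub>R 2) 0 + Adj 0 ((j * v) /\<^sub>R 2)" for v :: 'a
    have fg: "bounded_linear f" "bounded_linear g"
      unfolding f_def[abs_def] g_def[abs_def]
      by (intro bounded_linear_add bounded_linear_compose[OF bounded_linear_Adj(1)]
          bounded_linear_compose[OF bounded_linear_Adj(2)]
          bounded_linear_compose[OF bounded_linear_scaleR_right] lin neg bounded_linear_ident)+
    have double: "(x + x) /\<^sub>R 2 = x" for x :: 'a
      by (simp flip: scaleR_2)
    have recover: "f (eval_root j z) + g (eval_root (- j) z) = z" for z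
    proof -
      have sum: "eval_root j z + eval_root (- j) z = base z + base z"
        by (simp add: eval_root_def)
      have "- j * eval_root j z + j * eval_root (- j) z
          = - (j * j) * adjoined z - (j * j) * adjoined z"
        by (simp add: eval_root_def algebra_simps)
      then have diff: "- j * eval_root j z + j * eval_root (- j) z = adjoined z + adjoined z"
        by (simp only: j) simp
      have "base (f (eval_root j z) + g (eval_root (- j) z))
          = (eval_root j z + eval_root (- j) z) /\<^sub>R 2"
        by (simp add: f_def g_def scaleR_add_right)
      moreover have "adjoined (f (eval_root j z) + g (eval_root (- j) z))
          = (- j * eval_root j z + j * eval_root (- j) z) /\<^sub>R 2"
        by (simp add: f_def g_def scaleR_add_right scaleR_diff_right)
      ultimately show ?thesis
        by (simp only: adj_eq_iff sum diff double)
    qed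
    have "bounded (range (\<lambda>n. f (eval_root j (orbit c n)) + g (eval_root (- j) (orbit c n))))"
      using bounded_linear_image[OF u fg(1)] bounded_linear_image[OF v fg(2)]
      by (intro bounded_plus_comp) (simp_all add: image_image)
    then show "bounded_orbit c"
      by (simp add: bounded_orbit_def recover)
  }
qed

section \<open>Bicomplex and tricomplex parameters\<close>

lemma bounded_orbit_bicomplex_iff:
  fixes c :: "complex adj"
  shows "bounded_orbit c \<longleftrightarrow> bounded_orbit (eval_root \<i> c) \<and> bounded_orbit (eval_root (- \<i>) c)"
  by (intro bounded_orbit_adj_iff bounded_linear_mult_right) simp

text \<open>The Euclidean norm on bicomplex numbers is not an algebra norm, but multiplication by the
  unit $i_2$ only permutes the coordinates up to sign, so it is an isometry.\<close>

lemma bounded_orbit_tricomplex_iff: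
  fixes c :: tricomplex
  shows "bounded_orbit c \<longleftrightarrow>
    bounded_orbit (eval_root (Adj 0 1) c) \<and> bounded_orbit (eval_root (- Adj 0 1) c)"
proof (rule bounded_orbit_adj_iff)
  show "bounded_linear ((*) (Adj 0 1 :: complex adj))"
    by (rule bounded_linear_intro[where K = 1])
       (simp_all add: algebra_simps norm_adj_eq adj_eq_iff)
qed (simp add: adj_eq_iff)

lemma bounded_orbit_span_iff:
  "bounded_orbit (x *\<^sub>R i\<^sub>1 + t *\<^sub>R i\<^sub>2 + y *\<^sub>R i\<^sub>3) \<longleftrightarrow>
     bounded_orbit (Adj (Complex 0 x) (of_real (t + y))) \<and>
     bounded_orbit (Adj (Complex 0 x) (of_real (t - y)))"
proof -
  have "eval_root (Adj 0 1) (x *\<^sub>R i\<^sub>1 + t *\<^sub>R i\<^sub>2 + y *\<^sub>R i\<^sub>3) = Adj (Complex 0 x) (of_real (t + y))"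
    "eval_root (- Adj 0 1) (x *\<^sub>R i\<^sub>1 + t *\<^sub>R i\<^sub>2 + y *\<^sub>R i\<^sub>3) = Adj (Complex 0 x) (of_real (t - y))"
    by (simp_all add: eval_root_def unit_defs adj_eq_iff complex_eq_iff)
  then show ?thesis
    by (simp only: bounded_orbit_tricomplex_iff[of "x *\<^sub>R i\<^sub>1 + t *\<^sub>R i\<^sub>2 + y *\<^sub>R i\<^sub>3"])
qed

text \<open>The case $y = 0$ of the previous lemma says that \<open>Adj (Complex 0 x) (of_real t)\<close> may be
  replaced by the tricomplex number $x i_1 + t i_2$.\<close>

lemma bounded_orbit_split:
  "bounded_orbit (x *\<^sub>R i\<^sub>1 + t *\<^sub>R i\<^sub>2 + y *\<^sub>R i\<^sub>3) \<longleftrightarrow>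
     bounded_orbit (x *\<^sub>R i\<^sub>1 + (t + y) *\<^sub>R i\<^sub>2) \<and> bounded_orbit (x *\<^sub>R i\<^sub>1 + (t - y) *\<^sub>R i\<^sub>2)"
  using bounded_orbit_span_iff[of x t y] bounded_orbit_span_iff[of x "t + y" 0]
    bounded_orbit_span_iff[of x "t - y" 0] by simp

text \<open>Evaluation at $i_2 = i_1$.\<close>

lemma bounded_orbit_imaginary:
  assumes "bounded_orbit (x *\<^sub>R i\<^sub>1 + t *\<^sub>R i\<^sub>2)"
  shows "bounded_orbit (Complex 0 (x + t))"
proof -
  have "bounded_orbit (Adj (Complex 0 x) (of_real t))"
    using assms bounded_orbit_span_iff[of x t 0] by simp
  moreover have "eval_root \<i> (Adj (Complex 0 x) (of_real t)) = Complex 0 (x + t)"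
    by (simp add: eval_root_def complex_eq_iff)
  ultimately show ?thesis
    by (metis bounded_orbit_bicomplex_iff)
qed

text \<open>Evaluation fixes numbers with vanishing adjoined coordinate, so a parameter in
  $\mathbb{C}(i_1)$ has a bounded orbit among the tricomplex numbers iff it has one among the
  complex numbers.\<close>

lemma mem_M\<^sub>1_iff: "of_real p + q *\<^sub>R i\<^sub>1 \<in> M\<^sub>1 \<longleftrightarrow> bounded_orbit (Complex p q)"
proof -
  let ?c = "of_real p + q *\<^sub>R i\<^sub>1 :: tricomplex" and ?b = "Adj (Complex p q) 0"
  have "eval_root (Adj 0 1) ?c = ?b" "eval_root (- Adj 0 1) ?c = ?b"
    by (simp_all add: eval_root_def unit_defs adj_eq_iff complex_eq_iff of_real_def)
  then have "bounded_orbit ?c \<longleftrightarrow> bounded_orbit ?b"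
    by (simp only: bounded_orbit_tricomplex_iff[of ?c]) simp
  also have "\<dots> \<longleftrightarrow> bounded_orbit (Complex p q)"
    by (simp add: bounded_orbit_bicomplex_iff[of ?b] eval_root_def)
  finally show ?thesis
    unfolding M\<^sub>1_def C_i\<^sub>1_def bounded_orbit_iff_P by auto
qed

lemma abs_le_Sup_imaginary:
  assumes "bounded_orbit (Complex p r)"
  shows "\<bar>r\<bar> \<le> Sup {q. \<exists>p. of_real p + q *\<^sub>R i\<^sub>1 \<in> M\<^sub>1}"
proof (rule cSup_upper)
  have "bounded_orbit (Complex p (- r))"
    using assms bounded_orbit_cnj[of "Complex p r"] by (simp add: complex_cnj)
  with assms have "bounded_orbit (Complex p \<bar>r\<bar>)"
    by (simp add: abs_if)
  then show "\<bar>r\<bar> \<in> {q. \<exists>p. of_real p + q *\<^sub>R i\<^sub>1 \<in> M\<^sub>1}"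
    by (auto simp: mem_M\<^sub>1_iff)
  show "bdd_above {q. \<exists>p. of_real p + q *\<^sub>R i\<^sub>1 \<in> M\<^sub>1}"
  proof (rule bdd_aboveI, clarify)
    fix q p
    assume "of_real p + q *\<^sub>R i\<^sub>1 \<in> M\<^sub>1"
    then have "norm (Complex p q) \<le> 2"
      by (simp only: mem_M\<^sub>1_iff norm_le_2_if_bounded_orbit)
    with abs_Im_le_cmod[of "Complex p q"] show "q \<le> 2"
      by simp
  qed
qed

section \<open>The Metabrot\<close>

lemma mem_span_i\<^sub>1_i\<^sub>2: "a \<in> span {i\<^sub>1, i\<^sub>2} \<longleftrightarrow> (\<exists>x t. a = x *\<^sub>R i\<^sub>1 + t *\<^sub>R i\<^sub>2)"
  by (simp add: span_breakdown_eq) (simp add: algebra_simps)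

lemma mem_span_i\<^sub>1_i\<^sub>2_i\<^sub>3:
  "a \<in> span {i\<^sub>1, i\<^sub>2, i\<^sub>3} \<longleftrightarrow> (\<exists>x t y. a = x *\<^sub>R i\<^sub>1 + t *\<^sub>R i\<^sub>2 + y *\<^sub>R i\<^sub>3)"
  by (simp add: span_breakdown_eq) (simp add: algebra_simps)

theorem proposition4:
  fixes A :: "tricomplex set" and m :: real
  defines "A \<equiv> {a \<in> span {i\<^sub>1, i\<^sub>2}. bounded (range (\<lambda>n. (P a ^^ n) 0))}"
    and "m \<equiv> Sup {q :: real. \<exists>p :: real. of_real p + q *\<^sub>R i\<^sub>1 \<in> M\<^sub>1}"
  shows "principal_slice i\<^sub>1 i\<^sub>2 i\<^sub>3 =
    (\<Union>y\<in>{- m..m}.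
      (\<lambda>s. s + y *\<^sub>R i\<^sub>3) ` (((\<lambda>a. a - y *\<^sub>R i\<^sub>2) ` A) \<inter> ((\<lambda>a. a + y *\<^sub>R i\<^sub>2) ` A)))"
  (is "_ = (\<Union>y\<in>_. ?S y)")
proof -
  have A: "a \<in> A \<longleftrightarrow> (\<exists>x t. a = x *\<^sub>R i\<^sub>1 + t *\<^sub>R i\<^sub>2) \<and> bounded_orbit a" for a
    by (simp add: A_def mem_span_i\<^sub>1_i\<^sub>2 bounded_orbit_iff_P)
  have slice: "c \<in> principal_slice i\<^sub>1 i\<^sub>2 i\<^sub>3 \<longleftrightarrow>
      (\<exists>x t y. c = x *\<^sub>R i\<^sub>1 + t *\<^sub>R i\<^sub>2 + y *\<^sub>R i\<^sub>3) \<and> bounded_orbit c" for c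
    by (simp add: principal_slice_def M\<^sub>3_def mem_span_i\<^sub>1_i\<^sub>2_i\<^sub>3 bounded_orbit_iff_P)
  have S: "c \<in> ?S y \<longleftrightarrow> (\<exists>x t. c = x *\<^sub>R i\<^sub>1 + t *\<^sub>R i\<^sub>2 + y *\<^sub>R i\<^sub>3) \<and> bounded_orbit c" for c y
  proof -
    have "c \<in> ?S y \<longleftrightarrow> (\<exists>s. c = s + y *\<^sub>R i\<^sub>3 \<and> s + y *\<^sub>R i\<^sub>2 \<in> A \<and> s - y *\<^sub>R i\<^sub>2 \<in> A)"
    proof -
      have "s \<in> (\<lambda>a. a - v) ` A \<longleftrightarrow> s + v \<in> A" "s \<in> (\<lambda>a. a + v) ` A \<longleftrightarrow> s - v \<in> A" for s v
        by (auto intro: image_eqI[of _ _ "s + v"] image_eqI[of _ _ "s - v"])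
      then show ?thesis
        by blast
    qed
    also have "\<dots> \<longleftrightarrow> (\<exists>x t. c = x *\<^sub>R i\<^sub>1 + t *\<^sub>R i\<^sub>2 + y *\<^sub>R i\<^sub>3 \<and>
        x *\<^sub>R i\<^sub>1 + (t + y) *\<^sub>R i\<^sub>2 \<in> A \<and> x *\<^sub>R i\<^sub>1 + (t - y) *\<^sub>R i\<^sub>2 \<in> A)"
    proof (intro iffI; elim exE conjE)
      fix s
      assume s: "c = s + y *\<^sub>R i\<^sub>3" "s + y *\<^sub>R i\<^sub>2 \<in> A" "s - y *\<^sub>R i\<^sub>2 \<in> A"
      then obtain x t' where "s + y *\<^sub>R i\<^sub>2 = x *\<^sub>R i\<^sub>1 + t' *\<^sub>R i\<^sub>2"
        using A by blast
      then have "s = x *\<^sub>R i\<^sub>1 + (t' - y) *\<^sub>R i\<^sub>2"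
        by (simp add: algebra_simps)
      then obtain t where "s = x *\<^sub>R i\<^sub>1 + t *\<^sub>R i\<^sub>2" ..
      with s show "\<exists>x t. c = x *\<^sub>R i\<^sub>1 + t *\<^sub>R i\<^sub>2 + y *\<^sub>R i\<^sub>3 \<and>
          x *\<^sub>R i\<^sub>1 + (t + y) *\<^sub>R i\<^sub>2 \<in> A \<and> x *\<^sub>R i\<^sub>1 + (t - y) *\<^sub>R i\<^sub>2 \<in> A"
        by (auto simp: scaleR_add_left scaleR_diff_left add_diff_eq simp flip: add.assoc)
    next
      fix x t
      assume "c = x *\<^sub>R i\<^sub>1 + t *\<^sub>R i\<^sub>2 + y *\<^sub>R i\<^sub>3"
        "x *\<^sub>R i\<^sub>1 + (t + y) *\<^sub>R i\<^sub>2 \<in> A" "x *\<^sub>R i\<^sub>1 + (t - y) *\<^sub>R i\<^sub>2 \<in> A"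
      then show "\<exists>s. c = s + y *\<^sub>R i\<^sub>3 \<and> s + y *\<^sub>R i\<^sub>2 \<in> A \<and> s - y *\<^sub>R i\<^sub>2 \<in> A"
        by (intro exI[of _ "x *\<^sub>R i\<^sub>1 + t *\<^sub>R i\<^sub>2"]) (simp add: algebra_simps)
    qed
    also have "\<dots> \<longleftrightarrow> (\<exists>x t. c = x *\<^sub>R i\<^sub>1 + t *\<^sub>R i\<^sub>2 + y *\<^sub>R i\<^sub>3) \<and> bounded_orbit c"
      using A bounded_orbit_split by blast
    finally show ?thesis .
  qed
  have "\<bar>y\<bar> \<le> m" if "bounded_orbit (x *\<^sub>R i\<^sub>1 + t *\<^sub>R i\<^sub>2 + y *\<^sub>R i\<^sub>3)" for x t y
  proof -
    have "bounded_orbit (Complex 0 (x + (t + y)))" "bounded_orbit (Complex 0 (x + (t - y)))"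
      using that unfolding bounded_orbit_split by (blast intro: bounded_orbit_imaginary)+
    then have "\<bar>x + (t + y)\<bar> \<le> m" "\<bar>x + (t - y)\<bar> \<le> m"
      unfolding m_def by (blast intro: abs_le_Sup_imaginary)+
    then show ?thesis
      by linarith
  qed
  then have "y \<in> {- m..m}" if "bounded_orbit (x *\<^sub>R i\<^sub>1 + t *\<^sub>R i\<^sub>2 + y *\<^sub>R i\<^sub>3)" for x t y
    using that by (fastforce simp: abs_le_iff)
  then show ?thesis
    unfolding set_eq_iff UN_iff slice S by blast
qed

end
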